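(* Let $w_1,w_2,w_3$ be positive integers such that $r$ divides none of $w_2w_3$, $w_1w_3$, $w_1w_2$. Then for every integer $n\ge 0$, as identities of polynomials in $y_1,y_2,y_3$, $$\begin{aligned} &\sum_{k+l+m=n}\binom{n}{k,l,m}B_{k,\chi,\xi^{w_2w_3}}(w_1y_1)B_{l,\chi,\xi^{w_1w_3}}(w_2y_2)B_{m,\chi,\xi^{w_1w_2}}(w_3y_3)\,w_1^{l+m}w_2^{k+m}w_3^{k+l}\\ &=\sum_{k+l+m=n}\binom{n}{k,l,m}B_{k,\chi,\xi^{w_2w_3}}(w_1y_1)B_{l,\chi,\xi^{w_1w_2}}(w_3y_2)B_{m,\chi,\xi^{w_1w_3}}(w_2y_3)\,w_1^{l+m}w_3^{k+m}w_2^{k+l}\\ &=\sum_{k+l+m=n}\binom{n}{k,l,m}B_{k,\chi,\xi^{w_1w_3}}(w_2y_1)B_{l,\chi,\xi^{w_2w_3}}(w_1y_2)B_{m,\chi,\xi^{w_1w_2}}(w_3y_3)\,w_2^{l+m}w_1^{k+m}w_3^{k+l}\\ &=\sum_{k+l+m=n}\binom{n}{k,l,m}B_{k,\chi,\xi^{w_1w_3}}(w_2y_1)B_{l,\chi,\xi^{w_1w_2}}(w_3y_2)B_{m,\chi,\xi^{w_2w_3}}(w_1y_3)\,w_2^{l+m}w_3^{k+m}w_1^{k+l}\\ &=\sum_{k+l+m=n}\binom{n}{k,l,m}B_{k,\chi,\xi^{w_1w_2}}(w_3y_1)B_{l,\chi,\xi^{w_2w_3}}(w_1y_2)B_{m,\chi,\xi^{w_1w_3}}(w_2y_3)\,w_3^{l+m}w_1^{k+m}w_2^{k+l}\\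 &=\sum_{k+l+m=n}\binom{n}{k,l,m}B_{k,\chi,\xi^{w_1w_2}}(w_3y_1)B_{l,\chi,\xi^{w_1w_3}}(w_2y_2)B_{m,\chi,\xi^{w_2w_3}}(w_1y_3)\,w_3^{l+m}w_2^{k+m}w_1^{k+l}. \end{aligned}$$
   Context: Let $p$ be a prime, $\mathbb{C}_p$ the completion of an algebraic closure of $\mathbb{Q}_p$, $d$ a positive integer, and $\chi$ a primitive Dirichlet character of conductor $d$, with values viewed in $\mathbb{C}_p$ via a fixed embedding $\overline{\mathbb{Q}}\to\mathbb{C}_p$ (as usual $\chi(a)=0$ if $\gcd(a,d)>1$; for $d=1$, $\chi\equiv 1$). Let $r$ be a positive integer with $\gcd(r,pd)=1$ and let $\xi\neq 1$ in $\mathbb{C}_p$ be an $r$-th root of unity. For a root of unity $\eta\in\mathbb{C}_p$, the generalized twisted Bernoulli polynomials $B_{n,\chi,\eta}(x)$ attached to $\chi$ and $\eta$ are defined by the power series identity $$\frac{t\,e^{xt}}{\eta^{d}e^{dt}-1}\sum_{a=0}^{d-1}\chi(a)\eta^{a}e^{at}=\sum_{n=0}^{\infty}B_{n,\chi,\eta}(x)\frac{t^{n}}{n!}.$$ (The left side is a power series in $t$ with coefficients in $\mathbb{C}_p[x]$, for any $\eta$.) Sums over $k+l+m=n$ run over all nonnegative integers $k,l,m$ with $k+l+m=n$, and $\binom{n}{k,l,m}=\frac{n!}{k!\,l!\,m!}$. *)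

theory Defs
  imports
    "HOL-Analysis.Abstract_Metric_Spaces"
    "HOL-Computational_Algebra.Computational_Algebra"
    "HOL-Number_Theory.Cong"
begin

definition padic_abs :: "nat \<Rightarrow> rat \<Rightarrow> real" where
  "padic_abs p x =
     (if x = 0 then 0
      else real p powi (int (multiplicity (int p) (snd (quotient_of x)))
                        - int (multiplicity (int p) (fst (quotient_of x)))))"

definition absolute_value :: "('a::field \<Rightarrow> real) \<Rightarrow> bool" where
  "absolute_value v \<longleftrightarrow>
     (\<forall>x. 0 \<le> v x) \<and> (\<forall>x. v x = 0 \<longleftrightarrow> x = 0) \<and>
     (\<forall>x y. v (x * y) = v x * v y) \<and> (\<forall>x y. v (x + y) \<le> v x + v y)"

definition is_subfield :: "('a::field) set \<Rightarrow> bool" where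
  "is_subfield K \<longleftrightarrow>
     0 \<in> K \<and> 1 \<in> K \<and> (\<forall>x\<in>K. \<forall>y\<in>K. x + y \<in> K \<and> x * y \<in> K) \<and>
     (\<forall>x\<in>K. - x \<in> K \<and> inverse x \<in> K)"

definition is_completion :: "('a::field \<Rightarrow> real) \<Rightarrow> 'a set \<Rightarrow> 'a set \<Rightarrow> bool" where
  "is_completion v K L \<longleftrightarrow>
     K \<subseteq> L \<and> Metric_space.mcomplete L (\<lambda>x y. v (x - y)) \<and>
     Metric_space.mtopology L (\<lambda>x y. v (x - y)) closure_of K = L"

definition is_algebraic_closure :: "('a::field) set \<Rightarrow> 'a set \<Rightarrow> bool" where
  "is_algebraic_closure K L \<longleftrightarrow>
     K \<subseteq> L \<and>
     (\<forall>x\<in>L. \<exists>f. f \<noteq> 0 \<and> (\<forall>i. coeff f i \<in> K) \<and> poly f x = 0) \<and>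
     (\<forall>f. degree f > 0 \<and> (\<forall>i. coeff f i \<in> L) \<longrightarrow> (\<exists>x\<in>L. poly f x = 0))"

text \<open>
  The library has no p-adic fields, so the construction of the p-adic complex numbers is
  expressed as a property of a field type with an absolute value: inside it there is a completion
  K of the rationals for the p-adic absolute value, inside it an algebraic closure L of K,
  and the whole type is the completion of L for the given absolute value, which on L is the unique
  extension of the one on K. This determines the field up to isometric isomorphism.
\<close>

definition is_padic_complex_field :: "nat \<Rightarrow> ('a::field_char_0 \<Rightarrow> real) \<Rightarrow> bool" where
  "is_padic_complex_field p v \<longleftrightarrow>
     prime p \<and> absolute_value v \<and> (\<forall>q. v (of_rat q) = padic_abs p q) \<and>
     (\<exists>K L. is_subfield K \<and> is_completion v \<rat> K \<and>
            is_subfield L \<and> is_algebraic_closure K L \<and>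
            is_completion v L UNIV)"

text \<open>
  Embeddings of the field of algebraic numbers, taken inside the complex numbers; the values
  off the algebraic numbers are irrelevant. Injectivity is automatic.
\<close>

definition is_Qbar_embedding :: "(complex \<Rightarrow> 'a::field_char_0) \<Rightarrow> bool" where
  "is_Qbar_embedding \<iota> \<longleftrightarrow>
     \<iota> 1 = 1 \<and>
     (\<forall>x y. algebraic x \<and> algebraic y \<longrightarrow> \<iota> (x + y) = \<iota> x + \<iota> y \<and> \<iota> (x * y) = \<iota> x * \<iota> y)"

definition dirichlet_character :: "nat \<Rightarrow> (int \<Rightarrow> complex) \<Rightarrow> bool" where
  "dirichlet_character d chi \<longleftrightarrow>
     d > 0 \<and> chi 1 = 1 \<and> (\<forall>a b. chi (a * b) = chi a * chi b) \<and>
     (\<forall>a. chi (a + int d) = chi a) \<and> (\<forall>a. chi a = 0 \<longleftrightarrow> \<not> coprime a (int d))"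

text \<open>The least f such that the character factors through the units modulo f.\<close>

definition conductor :: "nat \<Rightarrow> (int \<Rightarrow> complex) \<Rightarrow> nat" where
  "conductor d chi =
     (LEAST f. f > 0 \<and> f dvd d \<and>
        (\<forall>a b. coprime a (int d) \<and> coprime b (int d) \<and> [a = b] (mod int f) \<longrightarrow> chi a = chi b))"

definition primitive_dirichlet_character :: "nat \<Rightarrow> (int \<Rightarrow> complex) \<Rightarrow> bool" where
  "primitive_dirichlet_character d chi \<longleftrightarrow> dirichlet_character d chi \<and> conductor d chi = d"

text \<open>
  Power series in t with coefficients polynomials in x are of type \<open>'a poly fps\<close>;
  t is \<^const>\<open>fps_X\<close> and \<open>fps_exp c\<close> is the exponential series of ct.
\<close>

definition fps_to_poly_fps :: "'a::comm_ring_1 fps \<Rightarrow> 'a poly fps" where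
  "fps_to_poly_fps F = Abs_fps (\<lambda>n. [:fps_nth F n:])"

definition exp_xt :: "'a::field_char_0 poly fps" where
  "exp_xt = Abs_fps (\<lambda>n. monom (1 / fact n) n)"

definition twisted_denom :: "nat \<Rightarrow> 'a::field_char_0 \<Rightarrow> 'a fps" where
  "twisted_denom d \<eta> = fps_const (\<eta> ^ d) * fps_exp (of_nat d) - 1"

definition twisted_char_sum :: "nat \<Rightarrow> (int \<Rightarrow> 'a::field_char_0) \<Rightarrow> 'a \<Rightarrow> 'a fps" where
  "twisted_char_sum d chi \<eta> = (\<Sum>a<d. fps_const (chi (int a) * \<eta> ^ a) * fps_exp (of_nat a))"

text \<open>
  The quotient below is exact: the denominator divides t times the sum also when
  \<open>\<eta> ^ d = 1\<close>. The defining power series identity is the lemma that follows.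
\<close>

definition twisted_bernoulli ::
    "nat \<Rightarrow> (int \<Rightarrow> 'a::field_char_0) \<Rightarrow> 'a \<Rightarrow> nat \<Rightarrow> 'a poly" where
  "twisted_bernoulli d chi \<eta> n =
     smult (fact n)
       (fps_nth (fps_to_poly_fps (fps_X * twisted_char_sum d chi \<eta> / twisted_denom d \<eta>) * exp_xt) n)"

lemma fps_to_poly_fps_mult:
  "fps_to_poly_fps (F * G) = fps_to_poly_fps F * fps_to_poly_fps (G :: 'a::comm_ring_1 fps)"
proof (rule fps_ext)
  fix n
  have sum_const: "[:sum f A:] = (\<Sum>i\<in>A. [:f i:])" for f :: "nat \<Rightarrow> 'a" and A :: "nat set"
    by (induction A rule: infinite_finite_induct) (simp, simp, metis add_pCons add.right_neutral sum.insert)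
  show "fps_nth (fps_to_poly_fps (F * G)) n = fps_nth (fps_to_poly_fps F * fps_to_poly_fps G) n"
    by (simp add: fps_to_poly_fps_def fps_mult_nth sum_const mult.commute)
qed

lemma twisted_denom_nonzero:
  assumes "d > 0"
  shows "twisted_denom d (\<eta> :: 'a::field_char_0) \<noteq> 0" and "subdegree (twisted_denom d \<eta>) \<le> 1"
proof -
  have "fps_nth (twisted_denom d \<eta>) 0 \<noteq> 0 \<or> fps_nth (twisted_denom d \<eta>) 1 \<noteq> 0"
    using assms by (cases "\<eta> = 0") (auto simp: twisted_denom_def power_0_left)
  then show "twisted_denom d \<eta> \<noteq> 0" and "subdegree (twisted_denom d \<eta>) \<le> 1"
    using subdegree_leI[of "twisted_denom d \<eta>" 0] subdegree_leI[of "twisted_denom d \<eta>" 1] by auto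
qed

lemma smult_fact_cancel:
  assumes "smult (1 / fact n) f = smult (1 / fact n) (g :: 'a::field_char_0 poly)"
  shows "f = g"
proof -
  have "smult (fact n) (smult (1 / fact n) f) = smult (fact n) (smult (1 / fact n) g)"
    using assms by simp
  then show ?thesis by simp
qed

lemma twisted_bernoulli_iff:
  fixes chi :: "int \<Rightarrow> 'a::field_char_0"
  assumes "d > 0"
  shows "fps_to_poly_fps (twisted_denom d \<eta>) * Abs_fps (\<lambda>n. smult (1 / fact n) (B n))
           = fps_X * exp_xt * fps_to_poly_fps (twisted_char_sum d chi \<eta>)
         \<longleftrightarrow> B = twisted_bernoulli d chi \<eta>"
proof -
  define D N where "D = twisted_denom d \<eta>" and "N = twisted_char_sum d chi \<eta>"
  define S where "S = (\<lambda>B :: nat \<Rightarrow> 'a poly. Abs_fps (\<lambda>n. smult (1 / fact n) (B n)))"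
  have D: "D \<noteq> 0" "subdegree D \<le> 1"
    using twisted_denom_nonzero[OF assms, of \<eta>] by (auto simp: D_def)
  have X: "fps_to_poly_fps fps_X = (fps_X :: 'a poly fps)"
    by (rule fps_ext) (simp add: fps_to_poly_fps_def fps_X_nth)
  have "D dvd fps_X * N"
    using D by (cases "N = 0") (auto simp: fps_dvd_iff)
  then have "D * (fps_X * N / D) = fps_X * N"
    by (rule dvd_mult_div_cancel)
  then have lift: "fps_to_poly_fps D * fps_to_poly_fps (fps_X * N / D) = fps_X * fps_to_poly_fps N"
    by (simp only: fps_to_poly_fps_mult[symmetric] X[symmetric])
  have "S (twisted_bernoulli d chi \<eta>) = fps_to_poly_fps (fps_X * N / D) * exp_xt"
    by (rule fps_ext) (simp add: S_def twisted_bernoulli_def N_def D_def)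
  then have ident: "fps_to_poly_fps D * S (twisted_bernoulli d chi \<eta>)
      = fps_X * exp_xt * fps_to_poly_fps N"
    by (simp only: mult.assoc[symmetric] lift) (simp only: mult_ac)
  have "fps_to_poly_fps D \<noteq> 0"
  proof
    assume "fps_to_poly_fps D = 0"
    then have "fps_nth (fps_to_poly_fps D) n = 0" for n by simp
    then have "fps_nth D n = 0" for n by (simp add: fps_to_poly_fps_def)
    then show False using D(1) by (simp add: fps_eq_iff)
  qed
  then have "fps_to_poly_fps D * S B = fps_X * exp_xt * fps_to_poly_fps N
      \<longleftrightarrow> S B = S (twisted_bernoulli d chi \<eta>)"
    unfolding ident[symmetric] by simp
  also have "\<dots> \<longleftrightarrow> B = twisted_bernoulli d chi \<eta>"
    by (auto simp: S_def fps_eq_iff fun_eq_iff intro: smult_fact_cancel)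
  finally show ?thesis by (simp add: S_def D_def N_def)
qed

text \<open>
  The ring of polynomials in \<open>y\<^sub>1, y\<^sub>2, y\<^sub>3\<close> is the iterated polynomial ring
  \<open>'a poly poly poly\<close>, with scalars embedded by \<open>const3\<close>.
\<close>

definition const3 :: "'a::comm_ring_1 \<Rightarrow> 'a poly poly poly" where
  "const3 c = [:[:[:c:]:]:]"

definition Y1 :: "'a::comm_ring_1 poly poly poly" where "Y1 = [:[:[:0, 1:]:]:]"
definition Y2 :: "'a::comm_ring_1 poly poly poly" where "Y2 = [:[:0, 1:]:]"
definition Y3 :: "'a::comm_ring_1 poly poly poly" where "Y3 = [:0, 1:]"

definition subst3 :: "'a::comm_ring_1 poly \<Rightarrow> 'a poly poly poly \<Rightarrow> 'a poly poly poly" where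
  "subst3 f P = poly (map_poly const3 f) P"

text \<open>The division of natural numbers is exact when \<open>k + l + m = n\<close>.\<close>

definition trinomial :: "nat \<Rightarrow> nat \<Rightarrow> nat \<Rightarrow> nat \<Rightarrow> nat" where
  "trinomial n k l m = fact n div (fact k * fact l * fact m)"

end

theory Submission
  imports Defs
begin

text \<open>
  Let \<open>F\<^sub>\<eta>(t) e\<^sup>x\<^sup>t\<close> be the exponential generating function of the
  \<open>B\<^sub>k(x)\<close> twisted by \<open>\<eta>\<close>. Then that of the
  \<open>B\<^sub>k(w\<^sub>1 y) (w\<^sub>2 w\<^sub>3)\<^sup>k\<close> is
  \<open>F\<^sub>\<eta>(w\<^sub>2 w\<^sub>3 t) exp (w\<^sub>1 w\<^sub>2 w\<^sub>3 y t)\<close>, where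
  \<open>\<eta> = \<xi> ^ (w\<^sub>2 w\<^sub>3)\<close>. Hence each of the six sums is \<open>n!\<close> times the
  \<open>n\<close>-th coefficient of one product of three factors \<open>F\<close>, one for each of
  \<open>w\<^sub>2 w\<^sub>3\<close>, \<open>w\<^sub>1 w\<^sub>3\<close>, \<open>w\<^sub>1 w\<^sub>2\<close>, and of the exponentials
  \<open>exp (w\<^sub>1 w\<^sub>2 w\<^sub>3 y\<^sub>i t)\<close>. This product is symmetric in
  \<open>w\<^sub>1, w\<^sub>2, w\<^sub>3\<close>.
\<close>

lemma const3_0 [simp]: "const3 0 = 0"
  and const3_1: "const3 1 = 1"
  and const3_add: "const3 (a + b) = const3 a + const3 b"
  and const3_mult: "const3 (a * b) = const3 a * const3 b"
  by (simp_all add: const3_def one_pCons)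

lemma const3_of_nat: "const3 (of_nat k) = of_nat k"
  by (induction k) (simp_all add: const3_1 const3_add)

lemma subst3_0 [simp]: "subst3 0 P = 0"
  by (simp add: subst3_def)

lemma subst3_add: "subst3 (f + g) P = subst3 f P + subst3 g P"
proof -
  have "map_poly const3 (f + g) = map_poly const3 f + map_poly const3 g"
    by (rule poly_eqI) (simp add: coeff_map_poly const3_add)
  then show ?thesis by (simp add: subst3_def)
qed

lemma subst3_sum: "subst3 (sum f A) P = (\<Sum>x\<in>A. subst3 (f x) P)"
  by (induction A rule: infinite_finite_induct) (simp_all add: subst3_add)

lemma subst3_monom: "subst3 (monom c k) P = const3 c * P ^ k"
  by (simp add: subst3_def map_poly_monom poly_monom)

text \<open>This is \<open>F(u t)\<close>, over the ring in which the identities live.\<close>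

definition scaled_fps3 :: "'a::comm_ring_1 fps \<Rightarrow> nat \<Rightarrow> 'a poly poly poly fps" where
  "scaled_fps3 F u = Abs_fps (\<lambda>k. const3 (fps_nth F k) * of_nat u ^ k)"

text \<open>Needed because \<^const>\<open>fps_exp\<close> is available over fields only.\<close>

definition exp3 :: "'a::field_char_0 poly poly poly \<Rightarrow> 'a poly poly poly fps" where
  "exp3 P = Abs_fps (\<lambda>k. const3 (1 / fact k) * P ^ k)"

text \<open>By definition the generating function is \<open>F(t) exp(x t)\<close>; put
  \<open>P\<close> for \<open>x\<close> and \<open>u t\<close> for \<open>t\<close>.\<close>

lemma twisted_bernoulli_egf:
  fixes chi :: "int \<Rightarrow> 'a::field_char_0"
  shows "Abs_fps (\<lambda>k. const3 (1 / fact k) * subst3 (twisted_bernoulli d chi \<eta> k) P * of_nat u ^ k)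
     = scaled_fps3 (fps_X * twisted_char_sum d chi \<eta> / twisted_denom d \<eta>) u * exp3 (of_nat u * P)"
proof (rule fps_ext)
  fix k
  define F where "F = fps_X * twisted_char_sum d chi \<eta> / twisted_denom d \<eta>"
  have "twisted_bernoulli d chi \<eta> k
      = (\<Sum>i=0..k. monom (fact k * (fps_nth F i * (1 / fact (k - i)))) (k - i))"
    unfolding twisted_bernoulli_def F_def[symmetric]
    \<comment> \<open>Simplifying this instance of \<open>sum_distrib_left\<close> turns the product
      with a constant polynomial into \<open>smult\<close>, which then moves inside the sum.\<close>
    by (simp add: fps_mult_nth fps_to_poly_fps_def exp_xt_def smult_monom
        sum_distrib_left[where r = "[:fact k:]", simplified])
  then have "const3 (1 / fact k) * subst3 (twisted_bernoulli d chi \<eta> k) P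
      = (\<Sum>i=0..k. const3 (fps_nth F i * (1 / fact (k - i))) * P ^ (k - i))"
    by (simp add: subst3_sum subst3_monom sum_distrib_left mult.assoc[symmetric]
        const3_mult[symmetric])
  \<comment> \<open>The exponent \<open>k\<close> is split as \<open>i + (k - i)\<close> so that
    each factor of the Cauchy product receives its own power of \<open>u\<close>.\<close>
  then have "const3 (1 / fact k) * subst3 (twisted_bernoulli d chi \<eta> k) P * of_nat u ^ k
      = (\<Sum>i=0..k. const3 (fps_nth F i * (1 / fact (k - i))) * P ^ (k - i) * of_nat u ^ (i + (k - i)))"
    by (simp add: sum_distrib_right)
  also have "\<dots> = fps_nth (scaled_fps3 F u * exp3 (of_nat u * P)) k"
    unfolding fps_mult_nth scaled_fps3_def exp3_def
    by (intro sum.cong refl) (simp only: const3_mult power_add power_mult_distrib fps_nth_Abs_fps mult_ac)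
  finally show "fps_nth (Abs_fps (\<lambda>k. const3 (1 / fact k) *
        subst3 (twisted_bernoulli d chi \<eta> k) P * of_nat u ^ k)) k
      = fps_nth (scaled_fps3 (fps_X * twisted_char_sum d chi \<eta> / twisted_denom d \<eta>) u *
        exp3 (of_nat u * P)) k"
    by (simp add: F_def)
qed

text \<open>Two nested Cauchy products run over pairs with \<open>k \<le> i \<le> n\<close>; these
  match the triples through \<open>i = k + l\<close>.\<close>

lemma fps_nth_mult3:
  fixes f g h :: "'a::comm_semiring_1 fps"
  shows "fps_nth (f * g * h) n
     = (\<Sum>(k, l, m)\<in>{(k, l, m). k + l + m = n}. fps_nth f k * fps_nth g l * fps_nth h m)"
proof -
  have "fps_nth (f * g * h) n
      = (\<Sum>(i, k)\<in>(SIGMA i:{0..n}. {0..i}). fps_nth f k * fps_nth g (i - k) * fps_nth h (n - i))"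
    by (simp add: fps_mult_nth sum_distrib_right sum.Sigma)
  also have "\<dots> = (\<Sum>(k, l, m)\<in>{(k, l, m). k + l + m = n}. fps_nth f k * fps_nth g l * fps_nth h m)"
    by (rule sum.reindex_bij_witness[where i = "\<lambda>(k, l, m). (k + l, k)"
          and j = "\<lambda>(i, k). (k, i - k, n - i)"]) auto
  finally show ?thesis .
qed

text \<open>Separates the coefficient so that each inverse factorial joins one generating
  function.\<close>

lemma const3_trinomial:
  "of_nat (trinomial (k + l + m) k l m)
     = const3 (fact (k + l + m)) * const3 (1 / fact k) * const3 (1 / fact l)
       * (const3 (1 / fact m) :: 'a::field_char_0 poly poly poly)"
proof -
  \<comment> \<open>Exactness of \<open>div\<close> follows from two binomial divisibilities: first
    \<open>k\<close> with \<open>l\<close>, then \<open>k + l\<close> with \<open>m\<close>.\<close>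
  have "fact k * fact l * fact m dvd (fact (k + l) * fact m :: nat)"
    by (intro mult_dvd_mono fact_fact_dvd_fact dvd_refl)
  also have "\<dots> dvd fact (k + l + m)"
    by (rule fact_fact_dvd_fact)
  finally obtain q where q: "(fact (k + l + m) :: nat) = fact k * fact l * fact m * q" ..
  then have "(fact (k + l + m) :: 'a) = fact k * fact l * fact m * of_nat q"
    by (metis of_nat_fact of_nat_mult)
  with q have "of_nat (trinomial (k + l + m) k l m)
      = (fact (k + l + m) * (1 / fact k) * (1 / fact l) * (1 / fact m) :: 'a)"
    by (simp add: trinomial_def)
  then show ?thesis
    by (metis const3_of_nat const3_mult)
qed

text \<open>Stated for arbitrary \<open>a\<close>, \<open>b\<close>, \<open>c\<close> so that all
  six sums are instances.\<close>

lemma trinomial_bernoulli_sum: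
  fixes d :: nat and chi :: "int \<Rightarrow> 'a::field_char_0" and \<xi> :: 'a
  defines "F \<equiv> \<lambda>u. scaled_fps3
    (fps_X * twisted_char_sum d chi (\<xi> ^ u) / twisted_denom d (\<xi> ^ u)) u"
  shows "(\<Sum>(k, l, m) \<in> {(k, l, m). k + l + m = n}. of_nat (trinomial n k l m) *
             subst3 (twisted_bernoulli d chi (\<xi> ^ (b * c)) k) (of_nat a * P) *
             subst3 (twisted_bernoulli d chi (\<xi> ^ (a * c)) l) (of_nat b * Q) *
             subst3 (twisted_bernoulli d chi (\<xi> ^ (a * b)) m) (of_nat c * R) *
             of_nat (a ^ (l + m) * b ^ (k + m) * c ^ (k + l)))
     = const3 (fact n) * fps_nth (F (b * c) * F (a * c) * F (a * b) *
         (exp3 (of_nat (a * b * c) * P) * exp3 (of_nat (a * b * c) * Q) *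
          exp3 (of_nat (a * b * c) * R))) n"
    (is "?S = _")
proof -
  define G where "G = (\<lambda>u P. Abs_fps (\<lambda>k. const3 (1 / fact k) *
    subst3 (twisted_bernoulli d chi (\<xi> ^ u) k) P * of_nat u ^ k))"
  have G: "G u (of_nat w * P) = F u * exp3 (of_nat (u * w) * P)" for u w P
    unfolding G_def F_def twisted_bernoulli_egf by (simp only: of_nat_mult mult.assoc)
  have "?S = const3 (fact n) *
      fps_nth (G (b * c) (of_nat a * P) * G (a * c) (of_nat b * Q) * G (a * b) (of_nat c * R)) n"
    unfolding fps_nth_mult3 sum_distrib_left
  proof (intro sum.cong refl, clarify)
    fix k l m assume "n = k + l + m"
    then show "of_nat (trinomial (k + l + m) k l m) *
             subst3 (twisted_bernoulli d chi (\<xi> ^ (b * c)) k) (of_nat a * P) *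
             subst3 (twisted_bernoulli d chi (\<xi> ^ (a * c)) l) (of_nat b * Q) *
             subst3 (twisted_bernoulli d chi (\<xi> ^ (a * b)) m) (of_nat c * R) *
             of_nat (a ^ (l + m) * b ^ (k + m) * c ^ (k + l))
      = const3 (fact (k + l + m)) * (fps_nth (G (b * c) (of_nat a * P)) k *
          fps_nth (G (a * c) (of_nat b * Q)) l * fps_nth (G (a * b) (of_nat c * R)) m)"
      \<comment> \<open>The weights regroup as
        \<open>(b * c) ^ k * (a * c) ^ l * (a * b) ^ m\<close>, one power for each
        \<open>G\<close>.\<close>
      by (simp only: G_def fps_nth_Abs_fps const3_trinomial of_nat_mult of_nat_power power_add
          power_mult_distrib mult_ac)
  qed
  \<comment> \<open>In each factor \<open>u * w\<close> is the full product
    \<open>a * b * c\<close>, so the exponentials no longer tell the three weights apart.\<close>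
  also have "G (b * c) (of_nat a * P) * G (a * c) (of_nat b * Q) * G (a * b) (of_nat c * R)
      = F (b * c) * F (a * c) * F (a * b) *
         (exp3 (of_nat (a * b * c) * P) * exp3 (of_nat (a * b * c) * Q) *
          exp3 (of_nat (a * b * c) * R))"
    unfolding G by (simp only: mult_ac)
  finally show ?thesis .
qed

theorem theorem4:
  fixes p d r w1 w2 w3 n :: nat
    and v :: "'a::field_char_0 \<Rightarrow> real"
    and \<iota> :: "complex \<Rightarrow> 'a"
    and chi :: "int \<Rightarrow> complex"
    and \<xi> :: 'a
  assumes "prime p"
    and "is_padic_complex_field p v"
    and "is_Qbar_embedding \<iota>"
    and "d > 0"
    and "primitive_dirichlet_character d chi"
    and "r > 0"
    and "coprime r (p * d)"
    and "\<xi> ^ r = 1"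
    and "\<xi> \<noteq> 1"
    and "w1 > 0" and "w2 > 0" and "w3 > 0"
    and "\<not> r dvd w2 * w3" and "\<not> r dvd w1 * w3" and "\<not> r dvd w1 * w2"
  shows
    "let B = (\<lambda>k \<eta> P. subst3 (twisted_bernoulli d (\<iota> \<circ> chi) \<eta> k) P);
        S1 = (\<Sum>(k, l, m) \<in> {(k, l, m). k + l + m = n}. of_nat (trinomial n k l m) *
             B k (\<xi> ^ (w2 * w3)) (of_nat w1 * Y1) *
             B l (\<xi> ^ (w1 * w3)) (of_nat w2 * Y2) *
             B m (\<xi> ^ (w1 * w2)) (of_nat w3 * Y3) *
             of_nat (w1 ^ (l + m) * w2 ^ (k + m) * w3 ^ (k + l)));
        S2 = (\<Sum>(k, l, m) \<in> {(k, l, m). k + l + m = n}. of_nat (trinomial n k l m) *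
             B k (\<xi> ^ (w2 * w3)) (of_nat w1 * Y1) *
             B l (\<xi> ^ (w1 * w2)) (of_nat w3 * Y2) *
             B m (\<xi> ^ (w1 * w3)) (of_nat w2 * Y3) *
             of_nat (w1 ^ (l + m) * w3 ^ (k + m) * w2 ^ (k + l)));
        S3 = (\<Sum>(k, l, m) \<in> {(k, l, m). k + l + m = n}. of_nat (trinomial n k l m) *
             B k (\<xi> ^ (w1 * w3)) (of_nat w2 * Y1) *
             B l (\<xi> ^ (w2 * w3)) (of_nat w1 * Y2) *
             B m (\<xi> ^ (w1 * w2)) (of_nat w3 * Y3) *
             of_nat (w2 ^ (l + m) * w1 ^ (k + m) * w3 ^ (k + l)));
        S4 = (\<Sum>(k, l, m) \<in> {(k, l, m). k + l + m = n}. of_nat (trinomial n k l m) *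
             B k (\<xi> ^ (w1 * w3)) (of_nat w2 * Y1) *
             B l (\<xi> ^ (w1 * w2)) (of_nat w3 * Y2) *
             B m (\<xi> ^ (w2 * w3)) (of_nat w1 * Y3) *
             of_nat (w2 ^ (l + m) * w3 ^ (k + m) * w1 ^ (k + l)));
        S5 = (\<Sum>(k, l, m) \<in> {(k, l, m). k + l + m = n}. of_nat (trinomial n k l m) *
             B k (\<xi> ^ (w1 * w2)) (of_nat w3 * Y1) *
             B l (\<xi> ^ (w2 * w3)) (of_nat w1 * Y2) *
             B m (\<xi> ^ (w1 * w3)) (of_nat w2 * Y3) *
             of_nat (w3 ^ (l + m) * w1 ^ (k + m) * w2 ^ (k + l)));
        S6 = (\<Sum>(k, l, m) \<in> {(k, l, m). k + l + m = n}. of_nat (trinomial n k l m) *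
             B k (\<xi> ^ (w1 * w2)) (of_nat w3 * Y1) *
             B l (\<xi> ^ (w1 * w3)) (of_nat w2 * Y2) *
             B m (\<xi> ^ (w2 * w3)) (of_nat w1 * Y3) *
             of_nat (w3 ^ (l + m) * w2 ^ (k + m) * w1 ^ (k + l)))
     in S1 = S2 \<and> S2 = S3 \<and> S3 = S4 \<and> S4 = S5 \<and> S5 = S6"
proof -
  \<comment> \<open>The goal writes each exponent of \<open>\<xi>\<close> with increasing indices;
    the instances must be brought to this form to match.\<close>
  note comm = mult.commute[of w2 w1] mult.commute[of w3 w1] mult.commute[of w3 w2]
  note S = trinomial_bernoulli_sum[where chi = "\<iota> \<circ> chi" and d = d and \<xi> = \<xi> and n = n
      and P = Y1 and Q = Y2 and R = Y3]
  \<comment> \<open>The positional arguments below stand for \<open>b\<close>, \<open>c\<close>,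
    \<open>a\<close>, in this order.\<close>
  show ?thesis
    unfolding Let_def
      S[of w2 w3 w1, unfolded comm] S[of w3 w2 w1, unfolded comm] S[of w1 w3 w2, unfolded comm]
      S[of w3 w1 w2, unfolded comm] S[of w1 w2 w3, unfolded comm] S[of w2 w1 w3, unfolded comm]
    by (intro conjI) (simp_all only: mult_ac)
qed

end
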